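(* For every integer $j>0$, the maximum exponent of an abelian power of period $F_j$ occurring as a factor in the Fibonacci word is equal to $\lfloor\phi F_j+F_{j-1}\rfloor$, where $\phi=(1+\sqrt5)/2$.
   Context: Fibonacci numbers: $F_0=1$, $F_1=1$, $F_{j+1}=F_j+F_{j-1}$ for $j\geq1$. The (infinite) Fibonacci word $f=abaababaabaab\cdots$ is the infinite word $c_0c_1c_2\cdots$ over $\{a,b\}$ with $c_n=b$ if $\{(n+1)(\phi-1)\}\in[0,2-\phi)$ and $c_n=a$ otherwise ($\{x\}$ is the fractional part); equivalently it is the limit of the finite words $f_0=b$, $f_1=a$, $f_j=f_{j-1}f_{j-2}$ for $j>1$. The Parikh vector of a word over $\{a,b\}$ is the pair (number of $a$'s, number of $b$'s). A word $w$ is an abelian power of period $m$ and exponent $k$ if $w=u_1u_2\cdots u_k$ where all $u_i$ have length $m$ and the same Parikh vector. *)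

theory Defs
  imports Complex_Main "HOL-Number_Theory.Fib"
begin

text \<open>The numbering \<open>F\<^sub>0 = F\<^sub>1 = 1\<close> is shifted by one with respect to the library's
  \<^const>\<open>fib\<close>, for which \<open>fib 0 = 0\<close>.\<close>

definition F :: "nat \<Rightarrow> nat" where
  "F j = fib (Suc j)"

lemma F_0: "F 0 = 1"
  and F_1: "F 1 = 1"
  and F_rec: "j \<ge> 1 \<Longrightarrow> F (j + 1) = F j + F (j - 1)"
  by (auto simp: F_def Suc_le_eq gr0_conv_Suc)

definition \<phi> :: real where
  "\<phi> = (1 + sqrt 5) / 2"

datatype letter = a | b

definition fibonacci_word :: "nat \<Rightarrow> letter" where
  "fibonacci_word n =
     (if frac (real (n + 1) * (\<phi> - 1)) \<in> {0..<2 - \<phi>} then b else a)"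

definition factor_of :: "'c list \<Rightarrow> (nat \<Rightarrow> 'c) \<Rightarrow> bool" where
  "factor_of w s \<longleftrightarrow> (\<exists>i. w = map s [i..<i + length w])"

definition parikh :: "letter list \<Rightarrow> nat \<times> nat" where
  "parikh w = (count_list w a, count_list w b)"

definition abelian_power :: "nat \<Rightarrow> nat \<Rightarrow> letter list \<Rightarrow> bool" where
  "abelian_power m k w \<longleftrightarrow>
     (\<exists>us. length us = k \<and> w = concat us \<and>
       (\<forall>u \<in> set us. length u = m) \<and>
       (\<forall>u \<in> set us. \<forall>v \<in> set us. parikh u = parikh v))"

definition abelian_exponents :: "(nat \<Rightarrow> letter) \<Rightarrow> nat \<Rightarrow> nat set" where
  "abelian_exponents s m = {k. \<exists>w. factor_of w s \<and> abelian_power m k w}"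

end

theory Submission
  imports Defs
begin

text \<open>Write \<open>\<alpha> = \<phi> - 1 = 1 / \<phi>\<close>. The letter at position \<open>n\<close> is \<open>a\<close> exactly when
  \<open>\<lfloor>(n + 2) \<alpha>\<rfloor> - \<lfloor>(n + 1) \<alpha>\<rfloor> = 1\<close>, so the number of \<open>a\<close>'s in a factor telescopes to a difference of
  two such floors. For the period \<open>m = F j\<close> the distance from \<open>m \<alpha>\<close> to the nearest integer is
  \<open>\<alpha> ^ (j + 1)\<close>. If \<open>k\<close> consecutive blocks of length \<open>m\<close> all contain \<open>c\<close> letters \<open>a\<close>, then
  \<open>\<bar>k (m \<alpha> - c)\<bar> < 1\<close> and hence \<open>k \<alpha> ^ (j + 1) < 1\<close>. Conversely, if \<open>k \<alpha> ^ (j + 1) < 1\<close>, a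
  starting point \<open>fib N\<close>, with \<open>N\<close> large and of the parity of \<open>j + 1\<close>, lies so close to an integer
  (on the correct side) that \<open>k\<close> rotations by \<open>m \<alpha>\<close> do not wrap around. So the exponents are
  the integers below \<open>\<phi> ^ (j + 1) = \<phi> F j + F (j - 1)\<close>, which is not an integer.\<close>

subsection \<open>The reciprocal of the golden ratio\<close>

definition \<alpha> :: real where
  "\<alpha> = \<phi> - 1"

lemma \<alpha>_square: "\<alpha> * \<alpha> = 1 - \<alpha>"
  by (simp add: \<alpha>_def \<phi>_def field_simps)

lemma \<alpha>_gt_half: "\<alpha> > 1 / 2"
proof -
  have "sqrt 5 > 2"
    by (rule real_less_rsqrt) simp
  then show ?thesis
    by (simp add: \<alpha>_def \<phi>_def)
qed

lemma \<alpha>_less_one: "\<alpha> < 1"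
proof -
  have "sqrt 5 < 3"
    by (rule real_less_lsqrt) simp_all
  then show ?thesis
    by (simp add: \<alpha>_def \<phi>_def)
qed

text \<open>\<open>- \<alpha>\<close> is a root of \<open>x^2 = x + 1\<close>, so its powers obey
  the Fibonacci recurrence. The error term tells how far, and by its sign on which side, the product
  lies from the integer \<open>fib n\<close>.\<close>

lemma fib_times_\<alpha>: "real (fib (Suc n)) * \<alpha> = real (fib n) - (- \<alpha>) ^ Suc n"
proof (induction n rule: fib.induct)
  case 1
  show ?case by simp
next
  case 2
  show ?case by (simp add: \<alpha>_square)
next
  case (3 n)
  have "(- \<alpha>) ^ Suc n + (- \<alpha>) ^ Suc (Suc n) = (- \<alpha>) ^ Suc n * (1 - \<alpha>)"
    by (simp add: algebra_simps)
  also have "\<dots> = (- \<alpha>) ^ Suc (Suc (Suc n))"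
    by (simp flip: \<alpha>_square add: algebra_simps)
  finally show ?case
    using 3 by (simp add: distrib_right del: power_Suc)
qed

text \<open>Makes \<open>fib j\<close> a nearest integer to \<open>F j * \<alpha>\<close> when
  \<open>j > 0\<close>. The bound fails at \<open>n = 1\<close>.\<close>

lemma \<alpha>_power_le_half:
  assumes "n \<ge> 2"
  shows "\<alpha> ^ n \<le> 1 / 2"
proof -
  have "\<alpha> ^ n \<le> \<alpha> ^ 2"
    using assms \<alpha>_gt_half \<alpha>_less_one by (intro power_decreasing) auto
  also have "\<dots> \<le> 1 / 2"
    using \<alpha>_square \<alpha>_gt_half by (simp add: power2_eq_square)
  finally show ?thesis .
qed

text \<open>The first factor is \<open>\<phi> ^ Suc n\<close>, and
  \<open>\<phi> * \<alpha> = 1\<close>: multiplying by \<open>\<alpha>\<close> lowers both Fibonacci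
  indices by one.\<close>

lemma \<phi>_fib_eq_inverse: "(\<phi> * real (fib (Suc n)) + real (fib n)) * \<alpha> ^ Suc n = 1"
proof (induction n)
  case 0
  show ?case using \<alpha>_square by (simp add: \<alpha>_def algebra_simps)
next
  case (Suc n)
  have "(\<phi> * real (fib (Suc (Suc n))) + real (fib (Suc n))) * \<alpha>
      = \<phi> * real (fib (Suc n)) + real (fib n)"
  proof -
    have *: "\<phi> * \<alpha> = 1" "\<phi> = 1 + \<alpha>"
      using \<alpha>_square by (simp_all add: \<alpha>_def algebra_simps)
    have "(\<phi> * (x + y) + x) * \<alpha> = (\<phi> * \<alpha>) * (x + y) + \<alpha> * x" for x y
      by (simp add: algebra_simps)
    also have "(\<phi> * \<alpha>) * (x + y) + \<alpha> * x = \<phi> * x + y" for x y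
      unfolding *(1) by (simp add: *(2) algebra_simps)
    finally show ?thesis
      by simp
  qed
  then show ?case
    using Suc by (metis mult.assoc power_Suc)
qed

text \<open>Since \<open>\<phi> = 1 + \<alpha>\<close>, the number is an integer minus a power of
  \<open>- \<alpha>\<close>, whose absolute value lies strictly between 0 and 1.\<close>

lemma \<phi>_fib_not_Ints: "\<phi> * real (fib (Suc n)) + real (fib n) \<notin> \<int>"
proof
  assume "\<phi> * real (fib (Suc n)) + real (fib n) \<in> \<int>"
  moreover have "\<phi> * real (fib (Suc n)) + real (fib n)
      = real (fib (Suc n) + 2 * fib n) - (- \<alpha>) ^ Suc n"
    using fib_times_\<alpha>[of n] by (simp add: \<alpha>_def algebra_simps)
  ultimately have "real (fib (Suc n) + 2 * fib n) - (- \<alpha>) ^ Suc n \<in> \<int>"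
    by metis
  then have "(- \<alpha>) ^ Suc n \<in> \<int>"
    by (metis Ints_diff Ints_of_nat add_diff_cancel_left' diff_add_cancel add.commute)
  moreover have "\<bar>(- \<alpha>) ^ Suc n\<bar> = \<alpha> ^ Suc n"
    using \<alpha>_gt_half by (simp add: power_abs abs_mult)
  moreover have "0 < \<alpha> ^ Suc n" "\<alpha> ^ Suc n < 1"
    using \<alpha>_gt_half \<alpha>_less_one by (auto intro: power_Suc_less_one simp del: power_Suc)
  ultimately show False
    using Ints_nonzero_abs_less1 by fastforce
qed

subsection \<open>Abelian powers as blocks of equal weight\<close>

lemma concat_blocks:
  "concat (map (\<lambda>t. map s [i + t * m..<i + t * m + m]) [0..<k]) = map s [i..<i + k * m]"
proof (induction k)
  case (Suc k)
  have "[i..<i + Suc k * m] = [i..<i + k * m] @ [i + k * m..<i + k * m + m]"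
    using upt_add_eq_append[of i "i + k * m" m] by (simp add: ac_simps)
  then show ?case
    using Suc by simp
qed simp

lemma nth_block:
  assumes "concat us = map s [i..<i + length us * m]" "\<forall>u \<in> set us. length u = m" "t < length us"
  shows "us ! t = map s [i + t * m..<i + t * m + m]"
  using assms
proof (induction us arbitrary: i t)
  case (Cons u us)
  have "[i..<i + length (u # us) * m] = [i..<i + m] @ [i + m..<i + m + length us * m]"
    using upt_add_eq_append[of i "i + m" "length us * m"] by (simp add: ac_simps)
  with Cons.prems have "u = map s [i..<i + m]"
    and "concat us = map s [i + m..<i + m + length us * m]"
    by auto
  with Cons.prems Cons.IH[of "i + m" "t - 1"] show ?case
    by (cases t) (auto simp: add.assoc)
qed simp

lemma count_list_a_plus_b: "count_list w a + count_list w b = length w"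
proof (induction w)
  case (Cons x w)
  then show ?case by (cases x) auto
qed simp

lemma parikh_eq_iff:
  assumes "length u = length v"
  shows "parikh u = parikh v \<longleftrightarrow> count_list u a = count_list v a"
  using assms count_list_a_plus_b[of u] count_list_a_plus_b[of v] by (auto simp: parikh_def)

text \<open>For blocks of equal length the count of \<open>a\<close> determines the Parikh vector. A
  common count \<open>c\<close> replaces the pairwise condition by one equation per block, which
  floors can express.\<close>

lemma mem_abelian_exponents_iff:
  "k \<in> abelian_exponents s m \<longleftrightarrow>
    (\<exists>i c. \<forall>t<k. count_list (map s [i + t * m..<i + t * m + m]) a = c)"
proof
  assume "k \<in> abelian_exponents s m"
  then obtain us i where us: "length us = k" "\<forall>u \<in> set us. length u = m"
      "\<forall>u \<in> set us. \<forall>v \<in> set us. parikh u = parikh v"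
      and w: "concat us = map s [i..<i + length (concat us)]"
    unfolding abelian_exponents_def abelian_power_def factor_of_def by blast
  have "length (concat us) = length us * m"
    using us(2) by (induction us) auto
  with w us have nth: "us ! t = map s [i + t * m..<i + t * m + m]" if "t < k" for t
    using that nth_block[of us s i m t] by simp
  have "count_list (map s [i + t * m..<i + t * m + m]) a = fst (parikh (us ! 0))" if "t < k" for t
  proof -
    have "parikh (us ! t) = parikh (us ! 0)"
      using us that by (metis nth_mem gr_zeroI less_nat_zero_code)
    then show ?thesis
      using nth[OF that] by (simp add: parikh_def)
  qed
  then show "\<exists>i c. \<forall>t<k. count_list (map s [i + t * m..<i + t * m + m]) a = c"
    by blast
next
  assume "\<exists>i c. \<forall>t<k. count_list (map s [i + t * m..<i + t * m + m]) a = c"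
  then obtain i c where c: "\<forall>t<k. count_list (map s [i + t * m..<i + t * m + m]) a = c"
    by blast
  define us where "us = map (\<lambda>t. map s [i + t * m..<i + t * m + m]) [0..<k]"
  have "concat us = map s [i..<i + k * m]"
    unfolding us_def by (rule concat_blocks)
  then have "factor_of (concat us) s"
    unfolding factor_of_def by (intro exI[of _ i]) simp
  moreover have "abelian_power m k (concat us)"
    unfolding abelian_power_def
  proof (intro exI[of _ us] conjI ballI)
    fix u v assume "u \<in> set us" "v \<in> set us"
    then show "parikh u = parikh v"
      using c by (subst parikh_eq_iff) (auto simp: us_def)
  qed (auto simp: us_def)
  ultimately show "k \<in> abelian_exponents s m"
    unfolding abelian_exponents_def by blast
qed

subsection \<open>Abelian powers in the Fibonacci word\<close>

text \<open>As \<open>0 < \<alpha> < 1\<close>, adding \<open>\<alpha>\<close> raises the floor of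
  \<open>x\<close> exactly when \<open>frac x \<ge> 1 - \<alpha>\<close>, and
  \<open>1 - \<alpha> = 2 - \<phi>\<close>.\<close>

lemma floor_diff_fibonacci_word:
  "\<lfloor>real (n + 2) * \<alpha>\<rfloor> = \<lfloor>real (n + 1) * \<alpha>\<rfloor> + (if fibonacci_word n = a then 1 else 0)"
proof -
  define x where "x = real (n + 1) * \<alpha>"
  have x2: "real (n + 2) * \<alpha> = x + \<alpha>"
    by (simp add: x_def algebra_simps)
  have word: "fibonacci_word n = (if frac x < 1 - \<alpha> then b else a)"
    by (simp add: fibonacci_word_def x_def \<alpha>_def)
  have "\<lfloor>x + \<alpha>\<rfloor> = \<lfloor>x\<rfloor> + (if frac x < 1 - \<alpha> then 0 else 1)"
    using \<alpha>_gt_half \<alpha>_less_one unfolding frac_def by (auto simp: floor_eq_iff) linarith+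
  then show ?thesis
    unfolding x2 x_def[symmetric] word by simp
qed

lemma count_a_fibonacci_word:
  "int (count_list (map fibonacci_word [i..<i + n]) a)
    = \<lfloor>real (i + n + 1) * \<alpha>\<rfloor> - \<lfloor>real (i + 1) * \<alpha>\<rfloor>"
proof (induction n)
  case (Suc n)
  have "real (i + Suc n + 1) = real (i + n + 2)"
    by simp
  with Suc floor_diff_fibonacci_word[of "i + n"] show ?case
    by (simp del: of_nat_add of_nat_Suc)
qed simp

lemma exponent_upper_bound:
  assumes "j > 0" "k \<in> abelian_exponents fibonacci_word (F j)"
  shows "real k * \<alpha> ^ Suc j < 1"
proof -
  define m where "m = F j"
  define A where "A t = \<lfloor>real (t + 1) * \<alpha>\<rfloor>" for t :: nat
  obtain i c where "\<forall>t<k. count_list (map fibonacci_word [i + t * m..<i + t * m + m]) a = c"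
    using assms(2) unfolding mem_abelian_exponents_iff m_def by blast
  then have step: "A (i + t * m + m) - A (i + t * m) = int c" if "t < k" for t
    using that count_a_fibonacci_word[of "i + t * m" m] unfolding A_def by simp
  have "t \<le> k \<Longrightarrow> A (i + t * m) = A i + int t * int c" for t
  proof (induction t)
    case (Suc t)
    then show ?case
      using step[of t] by (simp add: algebra_simps)
  qed simp
  then have "A (i + k * m) = A i + int k * int c"
    by simp
  moreover have "real (i + k * m + 1) * \<alpha> = real (i + 1) * \<alpha> + real k * (real m * \<alpha>)"
    by (simp add: algebra_simps)
  ultimately have "\<lfloor>real (i + 1) * \<alpha> + real k * (real m * \<alpha>)\<rfloor> = \<lfloor>real (i + 1) * \<alpha>\<rfloor> + int (k * c)"
    unfolding A_def by simp
  \<comment> \<open>The difference of two reals is less than 1 away from the difference of their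
    floors.\<close>
  then have "\<bar>real k * (real m * \<alpha>) - real (k * c)\<bar> < 1"
    by linarith
  then have k: "real k * \<bar>real m * \<alpha> - real c\<bar> < 1"
    by (metis abs_mult abs_of_nat right_diff_distrib of_nat_mult)
  define d where "d = (- \<alpha>) ^ Suc j"
  have abs_d: "\<bar>d\<bar> = \<alpha> ^ Suc j"
    using \<alpha>_gt_half unfolding d_def by (simp add: power_abs abs_mult)
  then have "\<bar>d\<bar> \<le> 1 / 2"
    using \<alpha>_power_le_half[of "Suc j"] assms(1) by simp
  moreover have "real m * \<alpha> = real (fib j) - d"
    using fib_times_\<alpha>[of j] by (simp add: m_def F_def d_def)
  \<comment> \<open>Every integer other than \<open>fib j\<close> is at distance at least
    \<open>1 - \<bar>d\<bar> \<ge> \<bar>d\<bar>\<close> from \<open>m * \<alpha>\<close>.\<close>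
  ultimately have "\<bar>d\<bar> \<le> \<bar>real m * \<alpha> - real c\<bar>"
    by (cases "fib j = c"; cases "fib j < c") auto
  then have "real k * \<bar>d\<bar> \<le> real k * \<bar>real m * \<alpha> - real c\<bar>"
    by (intro mult_left_mono) auto
  with k abs_d show ?thesis
    by simp
qed

lemma exponent_attained:
  assumes "real k * \<alpha> ^ Suc j < 1"
  shows "k \<in> abelian_exponents fibonacci_word (F j)"
proof -
  define q where "q = \<alpha> ^ Suc j"
  have q: "q > 0"
    using \<alpha>_gt_half by (simp add: q_def)
  have "(1 - real k * q) / q > 0"
    using q assms by (simp add: q_def)
  \<comment> \<open>The initial offset \<open>e * q\<close> must fit into the slack
    \<open>1 - k * q\<close>.\<close>
  then obtain r where r: "\<alpha> ^ r < (1 - real k * q) / q"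
    using real_arch_pow_inv \<alpha>_less_one by blast
  \<comment> \<open>The even exponent gives the initial offset \<open>e * d\<close> the sign of
    \<open>d\<close>, so that the rotations move further away from the integer instead of crossing
    it.\<close>
  define e where "e = \<alpha> ^ (2 * r)"
  have e: "e > 0"
    using \<alpha>_gt_half by (simp add: e_def)
  have "e \<le> \<alpha> ^ r"
    using \<alpha>_gt_half \<alpha>_less_one unfolding e_def by (intro power_decreasing) auto
  with r have "e < (1 - real k * q) / q"
    by simp
  then have eq: "(e + real k) * q < 1"
    using q by (simp add: field_simps)
  define N where "N = j + 2 * r"
  \<comment> \<open>The letter at position \<open>i\<close> is read off at
    \<open>(i + 1) * \<alpha>\<close>, hence the shift by one.\<close>
  define i where "i = fib (Suc N) - 1"
  have i: "i + 1 = fib (Suc N)"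
    using fib_neq_0_nat[of "Suc N"] by (simp add: i_def)
  define d where "d = (- \<alpha>) ^ Suc j"
  have abs_d: "\<bar>d\<bar> = q"
    using \<alpha>_gt_half unfolding d_def q_def by (simp add: power_abs abs_mult)
  have pos: "real (i + t * F j + 1) * \<alpha> = real (fib N + t * fib j) - (e + real t) * d" for t
  proof -
    have "real (i + t * F j + 1) * \<alpha>
        = real (fib (Suc N)) * \<alpha> + real t * (real (fib (Suc j)) * \<alpha>)"
      unfolding i[symmetric] F_def by (simp add: algebra_simps)
    also have "\<dots> = real (fib N + t * fib j) - ((- \<alpha>) ^ Suc N + real t * d)"
      unfolding fib_times_\<alpha> d_def by (simp add: algebra_simps del: power_Suc)
    also have "(- \<alpha>) ^ Suc N = e * d"
      unfolding N_def e_def d_def by (simp add: power_add power_mult)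
    finally show ?thesis
      by (simp add: algebra_simps)
  qed
  \<comment> \<open>For \<open>d > 0\<close> all block boundaries give points just below integers,
    for \<open>d < 0\<close> just above. The correction \<open>z\<close> does not depend on
    \<open>t\<close> and cancels in differences.\<close>
  define z where "z = (if d > 0 then 1 else 0 :: int)"
  \<comment> \<open>The case \<open>t = k\<close> is included because it bounds the last
    block.\<close>
  have floor: "\<lfloor>real (i + t * F j + 1) * \<alpha>\<rfloor> = int (fib N + t * fib j) - z" if "t \<le> k" for t
  proof -
    have "(e + real t) * q \<le> (e + real k) * q"
      using that q by (intro mult_right_mono) auto
    with eq have "(e + real t) * q < 1"
      by simp
    moreover have "(e + real t) * q > 0"
      using e q by simp
    moreover have "d = q \<and> z = 1 \<or> d = - q \<and> z = 0"
      using abs_d q by (auto simp: z_def)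
    ultimately show ?thesis
      unfolding pos by (auto simp: floor_eq_iff simp del: of_nat_add of_nat_mult)
  qed
  have "count_list (map fibonacci_word [i + t * F j..<i + t * F j + F j]) a = fib j"
    if "t < k" for t
  proof -
    have "\<lfloor>real (i + t * F j + F j + 1) * \<alpha>\<rfloor> = int (fib N + Suc t * fib j) - z"
      using floor[of "Suc t"] that by (simp add: algebra_simps)
    with floor[of t] count_a_fibonacci_word[of "i + t * F j" "F j"] that show ?thesis
      by simp
  qed
  then show ?thesis
    unfolding mem_abelian_exponents_iff by blast
qed

theorem proposition6p1:
  fixes j :: nat
  assumes "j > 0"
  shows "finite (abelian_exponents fibonacci_word (F j)) \<and>
         abelian_exponents fibonacci_word (F j) \<noteq> {} \<and>
         int (Max (abelian_exponents fibonacci_word (F j))) =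
           \<lfloor>\<phi> * real (F j) + real (F (j - 1))\<rfloor>"
proof -
  define X where "X = \<phi> * real (F j) + real (F (j - 1))"
  have X: "X = \<phi> * real (fib (Suc j)) + real (fib j)"
    using assms by (simp add: X_def F_def)
  \<comment> \<open>The bound \<open>k < X\<close> is strict, so the floor of \<open>X\<close> is
    attained because \<open>X\<close> is not an integer.\<close>
  have "X \<noteq> real k" for k :: nat
    using \<phi>_fib_not_Ints[of j] unfolding X by (metis Ints_of_nat)
  moreover have "X * \<alpha> ^ Suc j = 1" "\<alpha> ^ Suc j > 0"
    using \<phi>_fib_eq_inverse[of j] \<alpha>_gt_half unfolding X by simp_all
  moreover have "X \<ge> 0"
    unfolding X using \<alpha>_gt_half by (simp add: \<alpha>_def)
  ultimately have less_iff: "real k * \<alpha> ^ Suc j < 1 \<longleftrightarrow> k \<le> nat \<lfloor>X\<rfloor>" for k :: nat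
  proof -
    have "real k * \<alpha> ^ Suc j < 1 \<longleftrightarrow> real k < X"
      using \<open>X * \<alpha> ^ Suc j = 1\<close> \<open>\<alpha> ^ Suc j > 0\<close> by (metis mult_less_cancel_right_pos)
    also have "\<dots> \<longleftrightarrow> real k \<le> X"
      using \<open>X \<noteq> real k\<close> by linarith
    also have "\<dots> \<longleftrightarrow> k \<le> nat \<lfloor>X\<rfloor>"
      using \<open>X \<ge> 0\<close> by (simp add: le_nat_iff le_floor_iff)
    finally show ?thesis .
  qed
  have "abelian_exponents fibonacci_word (F j) = {..nat \<lfloor>X\<rfloor>}"
    using exponent_upper_bound[OF assms] exponent_attained less_iff by blast
  moreover have "Max {..nat \<lfloor>X\<rfloor>} = nat \<lfloor>X\<rfloor>"
    by (intro Max_eqI) auto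
  ultimately show ?thesis
    using \<open>X \<ge> 0\<close> unfolding X_def[symmetric] by simp
qed

end
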